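(* Let $w$ be a model trained by FedKF in heterogeneous federated learning with $K$ clients whose local data distributions are $Dis_1,\ldots,Dis_K$, and let $\Omega=\{Dis_1,\ldots,Dis_K\}$. Let $Q\ge 1$ and let $\widehat{U}_1,\ldots,\widehat{U}_Q$ be arbitrary agnostic target domains, i.e. for each $i=1,\ldots,Q$, $\widehat{U}_i=\sum_{k=1}^{K}\widehat{p}_{i,k}\,Dis_k$ for some $\widehat{p}_{i,k}\ge 0$ with $\sum_{k=1}^{K}\widehat{p}_{i,k}=1$. Let $\widehat{\Omega}=\{\widehat{U}_1,\ldots,\widehat{U}_Q\}$, and let $WLP_w^{\Omega}$ and $WLP_w^{\widehat{\Omega}}$ be the worst-case performances of $w$ on $\Omega$ and on $\widehat{\Omega}$. Then $$WLP_w^{\widehat{\Omega}}\ \ge\ WLP_w^{\Omega}.$$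
   Context: Performance notions. A model $w$ is (the weight vector of) a classifier that assigns to each input $x$ a probability vector $h(w;x)$ over finitely many classes; its predicted label is an index of a maximal entry of $h(w;x)$ (with a fixed tie-breaking rule). Each $Dis_k$ is a probability distribution on labelled samples $(x,y)$. The test accuracy of $w$ on a distribution $P$ of labelled samples is the probability, for $(x,y)\sim P$, that the predicted label of $w$ at $x$ equals $y$. Write $a_w^k$ for the test accuracy of $w$ on $Dis_k$, and $MP_w^{\widehat{U}}$ (model performance) for the test accuracy of $w$ on a target distribution $\widehat{U}$. An agnostic target domain is a mixture distribution $\widehat{U}=\sum_{k=1}^K\widehat{p}_k Dis_k$ with $\widehat{p}_k\ge 0$ and $\sum_k\widehat{p}_k=1$. The worst-case (local) performances are $$WLP_w^{\Omega}=\min\{a_w^1,\ldots,a_w^K\},\qquad WLP_w^{\widehat{\Omega}}=\min\{MP_w^{\widehat{U}_1},\ldots,MP_w^{\widehat{U}_Q}\}.$$ Federated setting. There are $K$ clients; client $k$ holds a local dataset $\mathcal{D}_k$ with data distribution $Dis_k$. "Heterogeneous" means that the local datasets may be unbalanced and non-IID across clients (the $Dis_k$ may differ arbitrarily). FedKF. Inputs: number of clients $K$, selection rate $C$, rounds $T$, local epochs $E$, batch size $B$, learning rates $\beta,\eta$, an initial generator $\theta$ and an initial model $w^0$. Initialize $\hat w^0=w^0$, cached models $\hat w_k=w^0$ and local generators $\theta_k=\theta$ for all $k$. In each round $t=1,\ldots,T$ the server selects a random set $\mathcal{S}_t$ of $m=CK$ active clients. Each active client $k$ sets $w_k\leftarrow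 w^{t-1}$, takes $\hat w=\hat w^{t-1}$ as teacher model, and for each of $E$ epochs and each batch of $\mathcal{D}_k$ updates $\theta_k\leftarrow\theta_k-\beta\nabla\mathcal{L}_G(\theta_k)$ and then $w_k\leftarrow w_k-\eta\nabla\mathcal{L}(w_k)$; the result $w_k^t$ is sent to the server, which sets $\hat w_k\leftarrow w_k^t$. The server then sets $w^t=\sum_{k\in\mathcal{S}_t}|\mathcal{D}_k|w_k^t/\sum_{k\in\mathcal{S}_t}|\mathcal{D}_k|$ and $\hat w^t=\sum_{k=1}^K|\mathcal{D}_k|\hat w_k/\sum_{k=1}^K|\mathcal{D}_k|$. The trained model is $w^T$ or $\hat w^T$. Here, with $z\sim\mathcal{N}(0,I)$, $g(\theta_k;z)$ the generator output, $f(\hat w;\cdot)$ the teacher's feature vector, $\hat y$ the index of the largest entry of $h(\hat w;g(\theta_k;z))$, $\mathrm{CE}$ cross entropy, $\mathrm{IE}(p)=-\sum_i p_i\log p_i$, $\mathrm{KL}$ the Kullback–Leibler divergence, and hyperparameters $\lambda_1,\lambda_2,\gamma$: $\mathcal{L}_G=-\mathrm{IE}(\mathbb{E}_z[h(\hat w;g(\theta_k;z))])+\lambda_1\mathbb{E}_z[\mathrm{CE}(h(\hat w;g(\theta_k;z)),\hat y)]-\lambda_2\mathbb{E}_z[\|f(\hat w;g(\theta_k;z))\|_1]$ and $\mathcal{L}=\mathbb{E}_{(x,y)\sim\mathcal{D}_k}[\mathrm{CE}(h(w_k;x),y)]+\gamma\,\mathbb{E}_z[\mathrm{KL}(h(\hat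 w;g(\theta_k;z))\,\|\,h(w_k;g(\theta_k;z)))]$. *)

theory Defs
  imports "HOL-Probability.Probability" "HOL-Library.Multiset"
begin

section \<open>Models, samples and test accuracy\<close>

text \<open>
  The type \<open>'c\<close> is the finite set of classes, \<open>'w\<close> and \<open>'g\<close> are the parameter spaces of the
  classifier and of the generator, and \<open>'z\<close> is the noise space. For a model \<open>w\<close>, \<open>probs A w\<close> is
  \<open>h(w;\<cdot>)\<close> and \<open>feature A w\<close> is \<open>f(w;\<cdot>)\<close>; \<open>gen A \<theta>\<close> is \<open>g(\<theta>;\<cdot>)\<close>. The tie-breaking rule picks a label
  out of the set of labels whose entries are maximal.
\<close>

record ('x, 'c::finite, 'f::finite, 'w, 'g, 'z) architecture =
  inputs :: "'x measure"
  probs :: "'w \<Rightarrow> 'x \<Rightarrow> real ^ 'c"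
  feature :: "'w \<Rightarrow> 'x \<Rightarrow> real ^ 'f"
  gen :: "'g \<Rightarrow> 'z \<Rightarrow> 'x"
  tie_break :: "'c set \<Rightarrow> 'c"

definition samples ::
  "('x, 'c::finite, 'f::finite, 'w, 'g, 'z) architecture \<Rightarrow> ('x \<times> 'c) measure" where
  "samples A = inputs A \<Otimes>\<^sub>M count_space UNIV"

text \<open>The measurability clauses are what the expectations and accuracies below presuppose.\<close>

definition architecture_wf ::
  "('x, 'c::finite, 'f::finite, 'w, 'g, 'z::euclidean_space) architecture \<Rightarrow> bool" where
  "architecture_wf A \<longleftrightarrow>
     (\<forall>w. \<forall>x\<in>space (inputs A). (\<forall>c. 0 \<le> probs A w x $ c) \<and> (\<Sum>c\<in>UNIV. probs A w x $ c) = 1) \<and>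
     (\<forall>w. probs A w \<in> borel_measurable (inputs A)) \<and>
     (\<forall>w. feature A w \<in> borel_measurable (inputs A)) \<and>
     (\<forall>\<theta>. gen A \<theta> \<in> borel \<rightarrow>\<^sub>M inputs A) \<and>
     (\<forall>S. S \<noteq> {} \<longrightarrow> tie_break A S \<in> S)"

definition predicted_label ::
  "('x, 'c::finite, 'f::finite, 'w, 'g, 'z) architecture \<Rightarrow> 'w \<Rightarrow> 'x \<Rightarrow> 'c" where
  "predicted_label A w x = tie_break A {c. \<forall>c'. probs A w x $ c' \<le> probs A w x $ c}"

definition sample_distribution ::
  "('x, 'c::finite, 'f::finite, 'w, 'g, 'z) architecture \<Rightarrow> ('x \<times> 'c) measure \<Rightarrow> bool" where
  "sample_distribution A P \<longleftrightarrow> prob_space P \<and> sets P = sets (samples A)"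

definition test_accuracy ::
  "('x, 'c::finite, 'f::finite, 'w, 'g, 'z) architecture \<Rightarrow> 'w \<Rightarrow> ('x \<times> 'c) measure \<Rightarrow> real" where
  "test_accuracy A w P = measure P {s \<in> space P. predicted_label A w (fst s) = snd s}"

definition worst_case_performance ::
  "('x, 'c::finite, 'f::finite, 'w, 'g, 'z) architecture \<Rightarrow> 'w \<Rightarrow> ('x \<times> 'c) measure set \<Rightarrow> real" where
  "worst_case_performance A w \<Omega> = Min (test_accuracy A w ` \<Omega>)"

text \<open>The mixture distribution \<open>\<Sum>k. p k \<cdot> Dis k\<close> over the clients \<open>k = 1, \<dots>, K\<close>.\<close>

definition mixture ::
  "'a measure \<Rightarrow> nat \<Rightarrow> (nat \<Rightarrow> real) \<Rightarrow> (nat \<Rightarrow> 'a measure) \<Rightarrow> 'a measure" where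
  "mixture M K p Dis =
     measure_of (space M) (sets M) (\<lambda>X. \<Sum>k=1..K. ennreal (p k) * emeasure (Dis k) X)"

section \<open>Loss functions\<close>

text \<open>
  Losses are extended reals, so that cross entropy and divergence are infinite where they should
  be, rather than \<open>0\<close> through the convention \<open>ln 0 = 0\<close>. That convention is the right one in
  \<open>info_entropy\<close>, where it yields \<open>0 log 0 = 0\<close>, and for the summands of \<open>KL_div\<close> with \<open>p $ i = 0\<close>.
\<close>

definition cross_entropy :: "real ^ 'c::finite \<Rightarrow> 'c \<Rightarrow> ereal" where
  "cross_entropy p y = (if p $ y = 0 then \<infinity> else ereal (- ln (p $ y)))"

definition info_entropy :: "real ^ 'c::finite \<Rightarrow> real" where
  "info_entropy p = - (\<Sum>i\<in>UNIV. p $ i * ln (p $ i))"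

definition KL_div :: "real ^ 'c::finite \<Rightarrow> real ^ 'c \<Rightarrow> ereal" where
  "KL_div p q =
     (if \<exists>i. p $ i \<noteq> 0 \<and> q $ i = 0 then \<infinity>
      else ereal (\<Sum>i\<in>UNIV. p $ i * ln (p $ i / q $ i)))"

definition std_gaussian :: "'z::euclidean_space measure" where
  "std_gaussian = density lborel (\<lambda>z. ennreal (\<Prod>b\<in>Basis. std_normal_density (z \<bullet> b)))"

text \<open>Expectation over Gaussian noise of a nonnegative, possibly infinite, quantity.\<close>

definition noise_expectation :: "('z::euclidean_space \<Rightarrow> ereal) \<Rightarrow> ereal" where
  "noise_expectation u = enn2ereal (\<integral>\<^sup>+ z. e2ennreal (u z) \<partial>std_gaussian)"

record hyperparams =
  clients :: nat
  select_rate :: real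
  rounds :: nat
  epochs :: nat
  batch_size :: nat
  gen_rate :: real
  model_rate :: real
  lambda1 :: real
  lambda2 :: real
  gamma_kd :: real

definition generator_loss ::
  "('x, 'c::finite, 'f::finite, 'w, 'g, 'z::euclidean_space) architecture \<Rightarrow> hyperparams \<Rightarrow>
     'w \<Rightarrow> 'g \<Rightarrow> ereal" where
  "generator_loss A H w_teach \<theta> =
     - ereal (info_entropy (\<integral>z. probs A w_teach (gen A \<theta> z) \<partial>std_gaussian))
     + ereal (lambda1 H) * noise_expectation (\<lambda>z.
         cross_entropy (probs A w_teach (gen A \<theta> z)) (predicted_label A w_teach (gen A \<theta> z)))
     - ereal (lambda2 H) * noise_expectation (\<lambda>z.
         ereal (\<Sum>i\<in>UNIV. \<bar>feature A w_teach (gen A \<theta> z) $ i\<bar>))"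

text \<open>The multiset \<open>X\<close> is the data over which the empirical expectation is taken.\<close>

definition model_loss ::
  "('x, 'c::finite, 'f::finite, 'w, 'g, 'z::euclidean_space) architecture \<Rightarrow> hyperparams \<Rightarrow>
     'w \<Rightarrow> 'g \<Rightarrow> ('x \<times> 'c) multiset \<Rightarrow> 'w \<Rightarrow> ereal" where
  "model_loss A H w_teach \<theta> X w =
     (\<Sum>(x, y)\<in>#X. cross_entropy (probs A w x) y) / ereal (real (size X))
     + ereal (gamma_kd H) * noise_expectation (\<lambda>z.
         KL_div (probs A w_teach (gen A \<theta> z)) (probs A w (gen A \<theta> z)))"

section \<open>The FedKF algorithm\<close>

definition has_gradient :: "('a::real_inner \<Rightarrow> ereal) \<Rightarrow> 'a \<Rightarrow> 'a \<Rightarrow> bool" where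
  "has_gradient L v d \<longleftrightarrow>
     (\<exists>F. (\<forall>\<^sub>F u in nhds v. L u = ereal (F u)) \<and> (GDERIV F v :> d))"

text \<open>
  One gradient step. No differentiability of the losses is presupposed (think of ReLU networks):
  where the gradient does not exist, its value is left to convention, hence unconstrained.
\<close>

definition gradient_step :: "real \<Rightarrow> ('a::real_inner \<Rightarrow> ereal) \<Rightarrow> 'a \<Rightarrow> 'a \<Rightarrow> bool" where
  "gradient_step r L v v' \<longleftrightarrow>
     (\<exists>d. v' = v - r *\<^sub>R d \<and> ((\<exists>d'. has_gradient L v d') \<longrightarrow> has_gradient L v d))"

text \<open>A division of a dataset into batches of size \<open>B\<close>; only the last one may be smaller.\<close>

definition batching :: "nat \<Rightarrow> 'a multiset \<Rightarrow> 'a multiset list \<Rightarrow> bool" where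
  "batching B X bs \<longleftrightarrow>
     sum_list bs = X \<and> (\<forall>b\<in>set bs. b \<noteq> {#} \<and> size b \<le> B) \<and> (\<forall>b\<in>set (butlast bs). size b = B)"

text \<open>
  The flag \<open>mb\<close> covers the two readings of the empirical expectation in the local loss during the
  step for a batch \<open>b\<close>: it is taken over \<open>b\<close> if \<open>mb\<close> holds, and over the whole local dataset \<open>X\<close>
  otherwise.
\<close>

inductive local_steps ::
  "('x, 'c::finite, 'f::finite, 'w::euclidean_space, 'g::euclidean_space, 'z::euclidean_space)
     architecture \<Rightarrow> hyperparams \<Rightarrow> bool \<Rightarrow> ('x \<times> 'c) multiset \<Rightarrow> 'w \<Rightarrow>
     ('x \<times> 'c) multiset list \<Rightarrow> 'g \<times> 'w \<Rightarrow> 'g \<times> 'w \<Rightarrow> bool"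
  for A H mb X w_teach where
  local_steps_Nil: "local_steps A H mb X w_teach [] s s"
| local_steps_Cons:
    "\<lbrakk> gradient_step (gen_rate H) (generator_loss A H w_teach) \<theta> \<theta>';
       gradient_step (model_rate H) (model_loss A H w_teach \<theta>' (if mb then b else X)) w w';
       local_steps A H mb X w_teach bs (\<theta>', w') s \<rbrakk>
     \<Longrightarrow> local_steps A H mb X w_teach (b # bs) (\<theta>, w) s"

definition client_update ::
  "('x, 'c::finite, 'f::finite, 'w::euclidean_space, 'g::euclidean_space, 'z::euclidean_space)
     architecture \<Rightarrow> hyperparams \<Rightarrow> bool \<Rightarrow> ('x \<times> 'c) multiset \<Rightarrow> 'w \<Rightarrow>
     'g \<times> 'w \<Rightarrow> 'g \<times> 'w \<Rightarrow> bool" where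
  "client_update A H mb X w_teach s s' \<longleftrightarrow>
     (\<exists>bss. length bss = epochs H \<and> (\<forall>bs\<in>set bss. batching (batch_size H) X bs) \<and>
        local_steps A H mb X w_teach (concat bss) s s')"

text \<open>
  The state between rounds: the models \<open>w\<^sup>t\<close> and the teacher with hat, and for each client its
  cached model and its local generator.
\<close>

record ('w, 'g) fed_state =
  current :: "'w"
  teacher :: "'w"
  cached :: "nat \<Rightarrow> 'w"
  local_gen :: "nat \<Rightarrow> 'g"

definition weighted_average ::
  "(nat \<Rightarrow> 'a multiset) \<Rightarrow> nat set \<Rightarrow> (nat \<Rightarrow> 'w::real_vector) \<Rightarrow> 'w" where
  "weighted_average D S v =
     (\<Sum>k\<in>S. real (size (D k)) *\<^sub>R v k) /\<^sub>R (\<Sum>k\<in>S. real (size (D k)))"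

definition fedkf_round ::
  "('x, 'c::finite, 'f::finite, 'w::euclidean_space, 'g::euclidean_space, 'z::euclidean_space)
     architecture \<Rightarrow> hyperparams \<Rightarrow> bool \<Rightarrow> (nat \<Rightarrow> ('x \<times> 'c) multiset) \<Rightarrow>
     ('w, 'g) fed_state \<Rightarrow> ('w, 'g) fed_state \<Rightarrow> bool" where
  "fedkf_round A H mb D st st' \<longleftrightarrow>
     (\<exists>S \<subseteq> {1..clients H}. real (card S) = select_rate H * real (clients H) \<and>
        (\<forall>k\<in>S. client_update A H mb (D k) (teacher st)
                  (local_gen st k, current st) (local_gen st' k, cached st' k)) \<and>
        (\<forall>k. k \<notin> S \<longrightarrow> local_gen st' k = local_gen st k \<and> cached st' k = cached st k) \<and>
        current st' = weighted_average D S (cached st') \<and>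
        teacher st' = weighted_average D {1..clients H} (cached st'))"

definition fedkf_init :: "'w \<Rightarrow> 'g \<Rightarrow> ('w, 'g) fed_state" where
  "fedkf_init w0 \<theta>0 =
     \<lparr>current = w0, teacher = w0, cached = (\<lambda>_. w0), local_gen = (\<lambda>_. \<theta>0)\<rparr>"

text \<open>
  \<open>w\<close> is a possible outcome of FedKF: it results from some choice of the active clients in each
  round and of the batches in each local epoch.
\<close>

definition fedkf_trained ::
  "('x, 'c::finite, 'f::finite, 'w::euclidean_space, 'g::euclidean_space, 'z::euclidean_space)
     architecture \<Rightarrow> hyperparams \<Rightarrow> bool \<Rightarrow> (nat \<Rightarrow> ('x \<times> 'c) multiset) \<Rightarrow> 'w \<Rightarrow> 'g \<Rightarrow> 'w \<Rightarrow> bool" where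
  "fedkf_trained A H mb D w0 \<theta>0 w \<longleftrightarrow>
     (\<exists>st. (fedkf_round A H mb D ^^ rounds H) (fedkf_init w0 \<theta>0) st \<and>
           (w = current st \<or> w = teacher st))"

text \<open>
  The data of a federation. The datasets may be unbalanced, and the distributions may differ
  arbitrarily between clients.
\<close>

definition federation ::
  "('x, 'c::finite, 'f::finite, 'w, 'g, 'z::euclidean_space) architecture \<Rightarrow> hyperparams \<Rightarrow>
     (nat \<Rightarrow> ('x \<times> 'c) multiset) \<Rightarrow> (nat \<Rightarrow> ('x \<times> 'c) measure) \<Rightarrow> bool" where
  "federation A H D Dis \<longleftrightarrow>
     architecture_wf A \<and>
     1 \<le> clients H \<and> 0 < select_rate H \<and> select_rate H \<le> 1 \<and> 1 \<le> batch_size H \<and>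
     (\<forall>k\<in>{1..clients H}. D k \<noteq> {#} \<and> set_mset (D k) \<subseteq> space (samples A) \<and>
        sample_distribution A (Dis k))"

end

(* Accuracy is affine in the sample distribution, so the accuracy on a mixture is a convex
   combination of the client accuracies and hence at least their minimum. *)
theory Submission
  imports Defs
begin

text \<open>For a fixed \<open>w\<close>, accuracy is the probability of one event, the correct
  prediction, and probability is linear in the distribution. So \<open>test_accuracy_mixture\<close>
  turns the accuracy on each target into a weighted average of client accuracies, and
  \<open>le_convex_sum\<close> bounds that average below by their minimum. The bound is the same for
  every target, hence survives the minimum over targets. The measure-theoretic work is in
  \<open>emeasure_mixture\<close>: the formula given to \<open>measure_of\<close> really is the
  measure.\<close>

text \<open>A finite nonnegative combination of measures is countably additive. The identity extends
  to sets outside \<open>M\<close>, where both sides vanish, so it can be applied directly to the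
  event of a correct prediction.\<close>

lemma emeasure_mixture:
  assumes "\<And>k. k \<in> {1..K} \<Longrightarrow> sets (Dis k) = sets M"
  shows "emeasure (mixture M K p Dis) X = (\<Sum>k=1..K. ennreal (p k) * emeasure (Dis k) X)"
proof (cases "X \<in> sets M")
  case True
  have sets: "sets (mixture M K p Dis) = sets M"
    by (simp add: mixture_def)
  show ?thesis
  proof (rule emeasure_measure_of[OF mixture_def sets.space_closed])
    show "countably_additive (sets (mixture M K p Dis))
      (\<lambda>X. \<Sum>k=1..K. ennreal (p k) * emeasure (Dis k) X)"
    proof (rule countably_additiveI)
      fix E :: "nat \<Rightarrow> 'a set"
      assume E: "range E \<subseteq> sets (mixture M K p Dis)" "disjoint_family E"
      have "(\<Sum>i. \<Sum>k=1..K. ennreal (p k) * emeasure (Dis k) (E i))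
          = (\<Sum>k=1..K. \<Sum>i. ennreal (p k) * emeasure (Dis k) (E i))"
        \<comment> \<open>Every series in \<open>ennreal\<close> is summable, so the finite sum and
          the series commute freely.\<close>
        by (rule suminf_sum) simp
      also have "\<dots> = (\<Sum>k=1..K. ennreal (p k) * emeasure (Dis k) (\<Union>i. E i))"
      proof (rule sum.cong[OF refl])
        fix k assume "k \<in> {1..K}"
        then have "range E \<subseteq> sets (Dis k)"
          using E(1) assms sets by simp
        then show "(\<Sum>i. ennreal (p k) * emeasure (Dis k) (E i))
            = ennreal (p k) * emeasure (Dis k) (\<Union>i. E i)"
          using E(2) by (simp add: ennreal_suminf_cmult suminf_emeasure)
      qed
      finally show "(\<Sum>i. \<Sum>k=1..K. ennreal (p k) * emeasure (Dis k) (E i))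
          = (\<Sum>k=1..K. ennreal (p k) * emeasure (Dis k) (\<Union>i. E i))" .
    qed
  qed (simp_all add: sets True positive_def)
next
  case False
  then have "X \<notin> sets (mixture M K p Dis)"
    by (simp add: mixture_def)
  \<comment> \<open>\<open>emeasure\<close> takes the default value 0 on non-measurable
    sets.\<close>
  moreover have "emeasure (Dis k) X = 0" if "k \<in> {1..K}" for k
    using that False assms by (simp add: emeasure_notin_sets)
  ultimately show ?thesis
    by (simp add: emeasure_notin_sets)
qed

lemma measure_mixture:
  assumes "\<And>k. k \<in> {1..K} \<Longrightarrow> sets (Dis k) = sets M"
    and "\<And>k. k \<in> {1..K} \<Longrightarrow> finite_measure (Dis k)"
    and "\<And>k. k \<in> {1..K} \<Longrightarrow> 0 \<le> p k"
  shows "measure (mixture M K p Dis) X = (\<Sum>k=1..K. p k * measure (Dis k) X)"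
proof -
  have "emeasure (mixture M K p Dis) X = (\<Sum>k=1..K. ennreal (p k) * emeasure (Dis k) X)"
    using assms(1) by (rule emeasure_mixture)
  also have "\<dots> = (\<Sum>k=1..K. ennreal (p k * measure (Dis k) X))"
    by (intro sum.cong refl)
      (simp add: assms ennreal_mult finite_measure.emeasure_eq_measure)
  also have "\<dots> = ennreal (\<Sum>k=1..K. p k * measure (Dis k) X)"
    by (intro sum_ennreal) (simp add: assms)
  finally show ?thesis
    \<comment> \<open>\<open>ennreal\<close> sends negative reals to 0, so the real value can be
      read off only once the sum is known to be nonnegative.\<close>
    by (rule measure_eq_emeasure_eq_ennreal[rotated])
      (intro sum_nonneg mult_nonneg_nonneg assms(3) measure_nonneg)
qed

lemma test_accuracy_mixture:
  assumes "\<And>k. k \<in> {1..K} \<Longrightarrow> sample_distribution A (Dis k)"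
    and "\<And>k. k \<in> {1..K} \<Longrightarrow> 0 \<le> p k"
  shows "test_accuracy A w (mixture (samples A) K p Dis)
    = (\<Sum>k=1..K. p k * test_accuracy A w (Dis k))"
proof -
  have sets: "sets (Dis k) = sets (samples A)" and fin: "finite_measure (Dis k)"
    if "k \<in> {1..K}" for k
    using assms(1)[OF that] by (auto simp: sample_distribution_def prob_space_def)
  \<comment> \<open>The event in \<open>test_accuracy\<close> is cut out of the space of its own
    measure; equal spaces make it the same set for the mixture and all clients.\<close>
  have "space (mixture (samples A) K p Dis) = space (samples A)"
    by (simp add: mixture_def)
  moreover have "space (Dis k) = space (samples A)" if "k \<in> {1..K}" for k
    using sets[OF that] by (rule sets_eq_imp_space_eq)
  ultimately show ?thesis
    unfolding test_accuracy_def
    by (subst measure_mixture[OF sets fin assms(2)]) (auto intro!: sum.cong)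
qed

text \<open>Since the weights sum to 1, \<open>m\<close> is its own weighted average, which is then
  compared term by term.\<close>

lemma le_convex_sum:
  fixes a :: "'i \<Rightarrow> real"
  assumes "\<And>k. k \<in> I \<Longrightarrow> 0 \<le> p k" "sum p I = 1" "\<And>k. k \<in> I \<Longrightarrow> m \<le> a k"
  shows "m \<le> (\<Sum>k\<in>I. p k * a k)"
proof -
  have "m = (\<Sum>k\<in>I. p k * m)"
    by (simp add: assms(2) flip: sum_distrib_right)
  also have "\<dots> \<le> (\<Sum>k\<in>I. p k * a k)"
    by (intro sum_mono mult_left_mono assms)
  finally show ?thesis .
qed

theorem theoremV1:
  fixes A :: "('x, 'c::finite, 'f::finite, 'w::euclidean_space, 'g::euclidean_space,
                'z::euclidean_space) architecture"
    and H :: hyperparams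
    and mb :: bool
    and D :: "nat \<Rightarrow> ('x \<times> 'c) multiset"
    and Dis U :: "nat \<Rightarrow> ('x \<times> 'c) measure"
    and p :: "nat \<Rightarrow> nat \<Rightarrow> real"
    and w0 w :: 'w and \<theta>0 :: 'g
    and K Q :: nat
  assumes "federation A H D Dis"
    and "K = clients H"
    and "fedkf_trained A H mb D w0 \<theta>0 w"
    and "Q \<ge> 1"
    and "\<And>i k. i \<in> {1..Q} \<Longrightarrow> k \<in> {1..K} \<Longrightarrow> 0 \<le> p i k"
    and "\<And>i. i \<in> {1..Q} \<Longrightarrow> (\<Sum>k=1..K. p i k) = 1"
    and "\<And>i. i \<in> {1..Q} \<Longrightarrow> U i = mixture (samples A) K (p i) Dis"
  shows "worst_case_performance A w (U ` {1..Q}) \<ge> worst_case_performance A w (Dis ` {1..K})"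
proof -
  let ?m = "worst_case_performance A w (Dis ` {1..K})"
  have dist: "sample_distribution A (Dis k)" if "k \<in> {1..K}" for k
    using assms(1,2) that by (simp add: federation_def)
  have "?m \<le> test_accuracy A w (U i)" if i: "i \<in> {1..Q}" for i
  proof -
    have "?m \<le> (\<Sum>k=1..K. p i k * test_accuracy A w (Dis k))"
      using assms(5,6)[OF i]
      by (intro le_convex_sum) (auto simp: worst_case_performance_def intro!: Min_le)
    also have "\<dots> = test_accuracy A w (U i)"
      unfolding assms(7)[OF i] using dist assms(5)[OF i]
      by (rule test_accuracy_mixture[symmetric])
    finally show ?thesis .
  qed
  then show ?thesis
    \<comment> \<open>Only the minimum over targets is unfolded, so \<open>?m\<close> stays a fixed
      lower bound; \<open>Q \<ge> 1\<close> makes that minimum range over a nonempty set.\<close>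
    using \<open>Q \<ge> 1\<close> unfolding worst_case_performance_def[of A w "U ` {1..Q}"]
    by (subst Min_ge_iff) auto
qed

end
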